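(* Let $\mathbf A\in\mathbb C^{n\times n}$ with $\operatorname{Ind}\mathbf A=k$ and $\operatorname{rank}\mathbf A^{k+1}=\operatorname{rank}\mathbf A^{k}=r\le n$, let $\mathbf B\in\mathbb C^{n\times m}$, and let $\hat{\mathbf B}=\mathbf A^{k}\mathbf B$ with $j$-th column $\hat{\mathbf b}_{.j}$. Then the Drazin inverse solution $\mathbf X=\mathbf A^{D}\mathbf B=(x_{ij})\in\mathbb C^{n\times m}$ of $\mathbf A\mathbf X=\mathbf B$ satisfies, for all $i=1,\dots,n$, $j=1,\dots,m$, \[x_{ij}=\frac{\sum_{\beta\in J_{r,n}\{i\}}\left|\left(\mathbf A^{k+1}_{.i}(\hat{\mathbf b}_{.j})\right)^{\beta}_{\beta}\right|}{\sum_{\beta\in J_{r,n}}\left|(\mathbf A^{k+1})^{\beta}_{\beta}\right|}.\]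
   Context: $\operatorname{Ind}\mathbf A$ is the smallest nonnegative $k$ with $\operatorname{rank}\mathbf A^{k+1}=\operatorname{rank}\mathbf A^{k}$; the Drazin inverse $\mathbf A^{D}$ is the unique $\mathbf X$ with $\mathbf A^{k+1}\mathbf X=\mathbf A^{k}$, $\mathbf X\mathbf A\mathbf X=\mathbf X$, $\mathbf A\mathbf X=\mathbf X\mathbf A$. $\mathbf M_{.i}(\mathbf c)$ denotes $\mathbf M$ with its $i$-th column replaced by $\mathbf c$. $J_{r,n}$ is the set of strictly increasing sequences of $r$ elements of $\{1,\dots,n\}$, $J_{r,n}\{i\}=\{\beta\in J_{r,n}:i\in\beta\}$, $\mathbf M^{\beta}_{\beta}$ is the principal submatrix indexed by $\beta$, $|\cdot|$ is the determinant. *)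

theory Defs
  imports "Jordan_Normal_Form.DL_Rank" "Jordan_Normal_Form.DL_Submatrix" "Jordan_Normal_Form.Determinant"
begin

definition crank :: "nat \<Rightarrow> complex mat \<Rightarrow> nat" where
  "crank n A = vec_space.rank n A"

definition mat_ind :: "nat \<Rightarrow> complex mat \<Rightarrow> nat" where
  "mat_ind n A = (LEAST k. crank n (A ^\<^sub>m (k+1)) = crank n (A ^\<^sub>m k))"

definition drazin :: "nat \<Rightarrow> complex mat \<Rightarrow> complex mat" where
  "drazin n A = (THE X. X \<in> carrier_mat n n \<and>
      A ^\<^sub>m (mat_ind n A + 1) * X = A ^\<^sub>m (mat_ind n A) \<and>
      X * A * X = X \<and> A * X = X * A)"

definition Jrn :: "nat \<Rightarrow> nat \<Rightarrow> nat set set" where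
  "Jrn r n = {\<beta>. \<beta> \<subseteq> {0..<n} \<and> card \<beta> = r}"

end

theory Submission
  imports Defs
begin

text \<open>
  A full-rank factorization \<open>A\<^sup>k = F G\<close> in which the columns of \<open>F\<close> form a basis
  of the range of \<open>A\<^sup>k\<close> gives
  \<open>A F = F C\<close> with \<open>C\<close> invertible, because \<open>A\<^bsup>k+1\<^esup>\<close> has the same rank. Then \<open>G A = C G\<close> and
  \<open>G F = C\<^sup>k\<close>, so that the Drazin inverse is \<open>F C\<^bsup>-(k+1)\<^esup> G\<close> and \<open>M = A\<^bsup>k+1\<^esup> = F H\<close> with
  \<open>H = C G\<close> and \<open>H F = C\<^bsup>k+1\<^esup>\<close> invertible.

  A column \<open>x\<close> of the Drazin inverse solution thus lies in the range of \<open>F\<close>, and \<open>M x\<close> is the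
  corresponding column of \<open>A\<^sup>k B\<close>. Cramer's rule for \<open>t I + M\<close>, applied to \<open>x\<close>, reads
  \<open>t |(t I + M)\<^sub>i(x)| + |(t I + M)\<^sub>i(M x)| = x\<^sub>i |t I + M|\<close>. Expanding in principal minors and comparing
  coefficients of \<open>t\<^bsup>n-r\<^esup>\<close>, the first term contributes \<open>(r+1)\<close>-minors of a matrix that factors
  through \<open>F\<close>; these vanish, and the identity of the theorem remains. The denominator is
  nonzero: by \<open>t\<^sup>r |t I + F H| = t\<^sup>n |t I + H F|\<close> it equals \<open>|H F|\<close>.
\<close>

section \<open>Principal minors\<close>

lemma bij_betw_pick:
  assumes "finite I"
  shows "bij_betw (pick I) {0..<card I} I"
proof -
  have inj: "inj_on (pick I) {0..<card I}"
    by (rule inj_onI) (metis atLeastLessThan_iff nat_neq_iff pick_mono_le)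
  moreover have "pick I ` {0..<card I} \<subseteq> I"
    by (auto intro: pick_in_set_le)
  ultimately have "pick I ` {0..<card I} = I"
    using assms by (intro card_subset_eq) (auto simp: card_image)
  with inj show ?thesis by (simp add: bij_betw_def)
qed

lemma permutes_atLeastLessThan:
  "p permutes {0..<n} \<Longrightarrow> i < n \<Longrightarrow> p i < (n :: nat)"
  using permutes_in_image[of p "{0..<n}" i] by simp

text \<open>Conjugating with \<open>pick I\<close>, the increasing enumeration of \<open>I\<close>,
  matches permutations of \<open>{0..<card I}\<close> with permutations of \<open>I\<close> and
  preserves signs. The Leibniz sum is then indexed by \<open>I\<close> itself, so minors for
  different \<open>I\<close> can be compared inside \<open>{0..<n}\<close>.\<close>

lemma det_principal_submatrix:
  fixes M :: "'a :: comm_ring_1 mat"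
  assumes M: "M \<in> carrier_mat n n" and I: "I \<subseteq> {0..<n}"
  shows "det (submatrix M I I) = (\<Sum>p | p permutes I. signof p * (\<Prod>i\<in>I. M $$ (i, p i)))"
proof -
  let ?c = "card I" and ?f = "map_permutation {0..<card I} (pick I)"
  have fin: "finite I" using I finite_subset by blast
  note bij = bij_betw_pick[OF fin]
  have inj: "inj_on (pick I) {0..<?c}" using bij by (simp add: bij_betw_def)
  have set_eq: "{i. i < n \<and> i \<in> I} = I" using I by auto
  have sub: "submatrix M I I = mat ?c ?c (\<lambda>(i,j). M $$ (pick I i, pick I j))"
    using M unfolding submatrix_def by (simp add: set_eq)
  have bij_perm: "bij_betw ?f {p. p permutes {0..<?c}} {p. p permutes I}"
  proof -
    have "?f = (\<lambda>p x. if x \<in> I then pick I (p (inv_into {0..<?c} (pick I) x)) else x)"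
      using bij by (auto simp: map_permutation_def restrict_id_def bij_betw_def fun_eq_iff)
    with bij_betw_permutations[OF bij] show ?thesis by simp
  qed
  have "det (submatrix M I I) =
      (\<Sum>p | p permutes {0..<?c}. signof p * (\<Prod>i = 0..<?c. M $$ (pick I i, pick I (p i))))"
    unfolding sub
    by (subst det_def') (auto intro!: sum.cong prod.cong simp: permutes_atLeastLessThan)
  also have "\<dots> = (\<Sum>p | p permutes {0..<?c}. signof (?f p) * (\<Prod>i\<in>I. M $$ (i, ?f p i)))"
  proof (rule sum.cong[OF refl])
    fix p assume "p \<in> {p. p permutes {0..<?c}}"
    then have p: "p permutes {0..<?c}" by simp
    have "(\<Prod>i\<in>I. M $$ (i, ?f p i)) = (\<Prod>i = 0..<?c. M $$ (pick I i, ?f p (pick I i)))"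
      by (rule prod.reindex_bij_betw[OF bij, symmetric])
    also have "\<dots> = (\<Prod>i = 0..<?c. M $$ (pick I i, pick I (p i)))"
      by (intro prod.cong refl) (simp add: map_permutation_apply[OF inj])
    finally show "signof p * (\<Prod>i = 0..<?c. M $$ (pick I i, pick I (p i))) =
        signof (?f p) * (\<Prod>i\<in>I. M $$ (i, ?f p i))"
      using sign_map_permutation[OF inj p] by simp
  qed
  also have "\<dots> = (\<Sum>p | p permutes I. signof p * (\<Prod>i\<in>I. M $$ (i, p i)))"
    by (rule sum.reindex_bij_betw[OF bij_perm])
  finally show ?thesis .
qed

lemma permutes_superset_fixed_outside:
  assumes "I \<subseteq> S"
  shows "p permutes I \<longleftrightarrow> p permutes S \<and> (\<forall>i\<in>S - I. p i = i)"
  using assms permutes_subset[of p I S] permutes_superset[of p S I] permutes_not_in[of p I] by auto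

text \<open>Multiply out each Leibniz product; \<open>I\<close> records the rows in which the entry
  of \<open>M\<close> is chosen. In the other rows the diagonal term vanishes unless
  \<open>p\<close> fixes the row, so only permutations of \<open>I\<close> survive, and they sum to
  the principal minor.\<close>

lemma det_diag_add:
  fixes M :: "'a :: comm_ring_1 mat" and d :: "nat \<Rightarrow> 'a"
  assumes M: "M \<in> carrier_mat n n"
  shows "det (mat n n (\<lambda>(i,j). (if i = j then d i else 0) + M $$ (i,j))) =
    (\<Sum>I\<in>Pow {0..<n}. (\<Prod>i\<in>{0..<n} - I. d i) * det (submatrix M I I))"
proof -
  let ?S = "{0..<n}"
  let ?g = "\<lambda>p I. signof p * ((\<Prod>i\<in>I. M $$ (i, p i)) * (\<Prod>i\<in>?S - I. if i = p i then d i else 0))"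
  have "det (mat n n (\<lambda>(i,j). (if i = j then d i else 0) + M $$ (i,j))) =
      (\<Sum>p | p permutes ?S. signof p * (\<Prod>i\<in>?S. M $$ (i, p i) + (if i = p i then d i else 0)))"
    by (subst det_def') (auto intro!: sum.cong prod.cong simp: permutes_atLeastLessThan add.commute)
  also have "\<dots> = (\<Sum>p | p permutes ?S. \<Sum>I\<in>Pow ?S. ?g p I)"
    by (simp add: prod_add sum_distrib_left)
  also have "\<dots> = (\<Sum>I\<in>Pow ?S. \<Sum>p | p permutes ?S. ?g p I)"
    by (rule sum.swap)
  also have "\<dots> = (\<Sum>I\<in>Pow ?S. (\<Prod>i\<in>?S - I. d i) * det (submatrix M I I))"
  proof (rule sum.cong[OF refl])
    fix I assume "I \<in> Pow ?S"
    then have I: "I \<subseteq> ?S" by simp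
    have "(\<Sum>p | p permutes ?S. ?g p I) = (\<Sum>p | p permutes I. ?g p I)"
    proof (rule sum.mono_neutral_right)
      show "finite {p. p permutes ?S}" by (simp add: finite_permutations)
      show "{p. p permutes I} \<subseteq> {p. p permutes ?S}"
        using I permutes_subset by blast
      show "\<forall>p\<in>{p. p permutes ?S} - {p. p permutes I}. ?g p I = 0"
      proof
        fix p assume "p \<in> {p. p permutes ?S} - {p. p permutes I}"
        then obtain i where "i \<in> ?S - I" "p i \<noteq> i"
          using permutes_superset_fixed_outside[OF I, of p] by blast
        then have "(\<Prod>i\<in>?S - I. if i = p i then d i else 0) = 0"
           by (intro prod_zero bexI[of _ i]) auto
        then show "?g p I = 0" by simp
      qed
    qed
    also have "\<dots> = (\<Sum>p | p permutes I. (\<Prod>i\<in>?S - I. d i) * (signof p * (\<Prod>i\<in>I. M $$ (i, p i))))"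
    proof (rule sum.cong[OF refl])
      fix p assume "p \<in> {p. p permutes I}"
      then have "\<And>i. i \<in> ?S - I \<Longrightarrow> i = p i" by (simp add: permutes_not_in)
      then have "(\<Prod>i\<in>?S - I. if i = p i then d i else 0) = (\<Prod>i\<in>?S - I. d i)"
        by (intro prod.cong) auto
      then show "?g p I = (\<Prod>i\<in>?S - I. d i) * (signof p * (\<Prod>i\<in>I. M $$ (i, p i)))"
        by (simp add: ac_simps)
    qed
    also have "\<dots> = (\<Prod>i\<in>?S - I. d i) * det (submatrix M I I)"
      by (simp add: det_principal_submatrix[OF M I] sum_distrib_left)
    finally show "(\<Sum>p | p permutes ?S. ?g p I) = (\<Prod>i\<in>?S - I. d i) * det (submatrix M I I)" .
  qed
  finally show ?thesis .
qed

section \<open>Determinants of products through a smaller dimension\<close>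

lemma det_zero_col:
  fixes P :: "'a :: comm_ring_1 mat"
  assumes P: "P \<in> carrier_mat s s" and j: "j < s" and z: "\<And>i. i < s \<Longrightarrow> P $$ (i,j) = 0"
  shows "det P = 0"
proof -
  have "(\<Prod>k<s. P $$ (p k, k)) = 0" if "p permutes {0..<s}" for p
    using permutes_atLeastLessThan[OF that j] z j by (intro prod_zero) auto
  then show ?thesis by (simp add: det_col[OF P])
qed

text \<open>The selected rows of \<open>F\<close> and columns of \<open>K\<close> are padded with
  zeros to square matrices \<open>P\<close> and \<open>Q\<close> of size \<open>card I\<close>. The
  product is unchanged, and column \<open>r\<close> of \<open>P\<close> is zero because
  \<open>r < card I\<close>.\<close>

lemma minor_mult_eq_0:
  fixes F K :: "'a :: comm_ring_1 mat"
  assumes F: "F \<in> carrier_mat n r" and K: "K \<in> carrier_mat r n"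
    and I: "I \<subseteq> {0..<n}" and r: "r < card I"
  shows "det (submatrix (F * K) I I) = 0"
proof -
  let ?s = "card I"
  define P where "P = mat ?s ?s (\<lambda>(i,l). if l < r then F $$ (pick I i, l) else 0)"
  define Q where "Q = mat ?s ?s (\<lambda>(l,j). if l < r then K $$ (l, pick I j) else 0)"
  have PQ: "P \<in> carrier_mat ?s ?s" "Q \<in> carrier_mat ?s ?s" by (auto simp: P_def Q_def)
  have set_eq: "{i. i < n \<and> i \<in> I} = I" using I by auto
  have pick: "pick I i < n" if "i < ?s" for i
    using pick_in_set_le[OF that] I by auto
  have "submatrix (F * K) I I = P * Q"
  proof (rule eq_matI)
    fix i j assume "i < dim_row (P * Q)" "j < dim_col (P * Q)"
    then have ij: "i < ?s" "j < ?s" using PQ by auto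
    have "submatrix (F * K) I I $$ (i,j) = (F * K) $$ (pick I i, pick I j)"
      using ij F K by (subst submatrix_index) (auto simp: set_eq)
    also have "\<dots> = (\<Sum>l\<in>{0..<r}. F $$ (pick I i, l) * K $$ (l, pick I j))"
      using pick[OF ij(1)] pick[OF ij(2)] F K by (auto simp: scalar_prod_def)
    also have "\<dots> = (\<Sum>l\<in>{0..<?s}. P $$ (i,l) * Q $$ (l,j))"
      using r ij by (intro sum.mono_neutral_cong_left) (auto simp: P_def Q_def)
    also have "\<dots> = (P * Q) $$ (i,j)"
      using ij PQ by (simp add: scalar_prod_def)
    finally show "submatrix (F * K) I I $$ (i,j) = (P * Q) $$ (i,j)" .
  qed (use F K PQ in \<open>auto simp: dim_submatrix set_eq\<close>)
  moreover have "det P = 0"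
    by (rule det_zero_col[OF PQ(1) r]) (use r in \<open>auto simp: P_def\<close>)
  ultimately show ?thesis by (simp add: det_mult[OF PQ])
qed

text \<open>Sylvester's determinant identity, with powers of \<open>t\<close> on both sides so that
  \<open>t = 0\<close> is allowed. The block matrix \<open>T\<close> becomes block triangular both
  when multiplied by \<open>L\<close> on the right and by \<open>R\<close> on the left; the
  determinants of the two products are compared through \<open>det T\<close>.\<close>

lemma det_add_mult_commute:
  fixes F H :: "'a :: idom mat"
  assumes F: "F \<in> carrier_mat n r" and H: "H \<in> carrier_mat r n"
  shows "t ^ r * det (t \<cdot>\<^sub>m 1\<^sub>m n + F * H) = t ^ n * det (t \<cdot>\<^sub>m 1\<^sub>m r + H * F)"
proof -
  define T where "T = four_block_mat (t \<cdot>\<^sub>m 1\<^sub>m n) (- F) H (1\<^sub>m r)"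
  define L where "L = four_block_mat (1\<^sub>m n) (0\<^sub>m n r) (- H) (1\<^sub>m r)"
  define R where "R = four_block_mat (1\<^sub>m n) (0\<^sub>m n r) (- H) (t \<cdot>\<^sub>m 1\<^sub>m r)"
  have c: "T \<in> carrier_mat (n+r) (n+r)" "L \<in> carrier_mat (n+r) (n+r)" "R \<in> carrier_mat (n+r) (n+r)"
    using F H by (auto simp: T_def L_def R_def)
  have TL: "T * L = four_block_mat (t \<cdot>\<^sub>m 1\<^sub>m n + F * H) (- F) (0\<^sub>m r n) (1\<^sub>m r)"
    unfolding T_def L_def
    by (subst mult_four_block_mat[where ?nr1.0 = n and ?n1.0 = n and ?n2.0 = r and ?nr2.0 = r and ?nc1.0 = n and ?nc2.0 = r])
       (use F H in auto)
  have RT: "R * T = four_block_mat (t \<cdot>\<^sub>m 1\<^sub>m n) (- F) (0\<^sub>m r n) (t \<cdot>\<^sub>m 1\<^sub>m r + H * F)"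
    unfolding T_def R_def
    by (subst mult_four_block_mat[where ?nr1.0 = n and ?n1.0 = n and ?n2.0 = r and ?nr2.0 = r and ?nc1.0 = n and ?nc2.0 = r])
       (use F H in auto)
  have "det L = 1" unfolding L_def
    by (subst det_four_block_mat_upper_right_zero[of _ n _ r]) (use H in auto)
  moreover have "det R = t ^ r" unfolding R_def
    by (subst det_four_block_mat_upper_right_zero[of _ n _ r]) (use H in auto)
  moreover have "det (T * L) = det (t \<cdot>\<^sub>m 1\<^sub>m n + F * H)" unfolding TL
    by (subst det_four_block_mat_lower_left_zero[of _ n _ r]) (use F H in auto)
  moreover have "det (R * T) = t ^ n * det (t \<cdot>\<^sub>m 1\<^sub>m r + H * F)" unfolding RT
    by (subst det_four_block_mat_lower_left_zero[of _ n _ r]) (use F H in auto)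
  ultimately show ?thesis
    using det_mult[OF c(1,2)] det_mult[OF c(3,1)] by simp
qed

section \<open>Column replacement and principal minor expansions in a shift parameter\<close>

lemma replace_col_carrier [simp]:
  "M \<in> carrier_mat n m \<Longrightarrow> replace_col M c i \<in> carrier_mat n m"
  by (simp add: replace_col_def)

text \<open>The cofactors along column \<open>i\<close> do not see that column, so they are those of
  \<open>M\<close>. This makes linearity in the replaced column immediate.\<close>

lemma det_replace_col_expansion:
  fixes M :: "'a :: comm_ring_1 mat"
  assumes M: "M \<in> carrier_mat n n" and i: "i < n"
  shows "det (replace_col M v i) = (\<Sum>a<n. v $ a * cofactor M a i)"
proof -
  have R: "replace_col M v i \<in> carrier_mat n n" using M by simp
  have "cofactor (replace_col M v i) a i = cofactor M a i" if "a < n" for a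
  proof -
    have "mat_delete (replace_col M v i) a i = mat_delete M a i"
      using M by (intro eq_matI) (auto simp: mat_delete_def replace_col_def)
    then show ?thesis by (simp add: cofactor_def)
  qed
  then show ?thesis
    using M i by (subst laplace_expansion_column[OF R i]) (auto simp: replace_col_def intro!: sum.cong)
qed

lemma det_replace_col_linear:
  fixes M :: "'a :: comm_ring_1 mat"
  assumes M: "M \<in> carrier_mat n n" and i: "i < n"
    and u: "u \<in> carrier_vec n" and v: "v \<in> carrier_vec n"
  shows "det (replace_col M (t \<cdot>\<^sub>v u + v) i) = t * det (replace_col M u i) + det (replace_col M v i)"
  using u v
  by (simp add: det_replace_col_expansion[OF M i] sum.distrib sum_distrib_left distrib_right mult.assoc)

lemma det_shift_principal_minors:
  fixes M :: "'a :: comm_ring_1 mat"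
  assumes M: "M \<in> carrier_mat n n"
  shows "det (t \<cdot>\<^sub>m 1\<^sub>m n + M) = (\<Sum>I\<in>Pow {0..<n}. t ^ (n - card I) * det (submatrix M I I))"
proof -
  have "t \<cdot>\<^sub>m 1\<^sub>m n + M = mat n n (\<lambda>(a,b). (if a = b then t else 0) + M $$ (a,b))"
    using M by (intro eq_matI) auto
  then show ?thesis
    by (simp add: det_diag_add[OF M, of "\<lambda>_. t"])
       (intro sum.cong refl, auto simp: card_Diff_subset finite_subset)
qed

text \<open>The replaced column carries no \<open>t\<close>, so the diagonal summand is 0 at
  position \<open>i\<close> and \<open>t\<close> elsewhere. An index set that omits \<open>i\<close>
  picks up this zero factor.\<close>

lemma det_shift_replace_col_principal_minors:
  fixes M :: "'a :: comm_ring_1 mat"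
  assumes M: "M \<in> carrier_mat n n" and i: "i < n"
  shows "det (replace_col (t \<cdot>\<^sub>m 1\<^sub>m n + M) c i) =
    (\<Sum>I\<in>{I\<in>Pow {0..<n}. i \<in> I}. t ^ (n - card I) * det (submatrix (replace_col M c i) I I))"
proof -
  let ?d = "\<lambda>a. if a = i then 0 else t"
  have R: "replace_col M c i \<in> carrier_mat n n" using M by simp
  have "replace_col (t \<cdot>\<^sub>m 1\<^sub>m n + M) c i =
      mat n n (\<lambda>(a,b). (if a = b then ?d a else 0) + replace_col M c i $$ (a,b))"
    using M by (intro eq_matI) (auto simp: replace_col_def)
  then have "det (replace_col (t \<cdot>\<^sub>m 1\<^sub>m n + M) c i) =
      (\<Sum>I\<in>Pow {0..<n}. (\<Prod>a\<in>{0..<n} - I. ?d a) * det (submatrix (replace_col M c i) I I))"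
    by (simp add: det_diag_add[OF R])
  also have "\<dots> = (\<Sum>I\<in>{I\<in>Pow {0..<n}. i \<in> I}.
      t ^ (n - card I) * det (submatrix (replace_col M c i) I I))"
  proof (rule sum.mono_neutral_cong_right)
    show "\<forall>I\<in>Pow {0..<n} - {I\<in>Pow {0..<n}. i \<in> I}.
        (\<Prod>a\<in>{0..<n} - I. ?d a) * det (submatrix (replace_col M c i) I I) = 0"
    proof
      fix I assume "I \<in> Pow {0..<n} - {I\<in>Pow {0..<n}. i \<in> I}"
      then have "(\<Prod>a\<in>{0..<n} - I. ?d a) = 0"
        using i by (intro prod_zero) auto
      then show "(\<Prod>a\<in>{0..<n} - I. ?d a) * det (submatrix (replace_col M c i) I I) = 0"
        by simp
    qed
  next
    fix I assume I: "I \<in> {I\<in>Pow {0..<n}. i \<in> I}"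
    then have "(\<Prod>a\<in>{0..<n} - I. ?d a) = (\<Prod>a\<in>{0..<n} - I. t)"
      by (intro prod.cong) auto
    also have "\<dots> = t ^ (n - card I)"
      using I by (auto simp: card_Diff_subset finite_subset)
    finally show "(\<Prod>a\<in>{0..<n} - I. ?d a) * det (submatrix (replace_col M c i) I I) =
        t ^ (n - card I) * det (submatrix (replace_col M c i) I I)" by simp
  qed auto
  finally show ?thesis .
qed

text \<open>The expansions in powers of \<open>t\<close> above, as formal polynomials, so that their
  coefficients can be compared.\<close>

definition cocard_poly :: "nat \<Rightarrow> nat set set \<Rightarrow> (nat set \<Rightarrow> 'a) \<Rightarrow> 'a :: comm_ring_1 poly" where
  "cocard_poly n X a = (\<Sum>I\<in>X. monom (a I) (n - card I))"

lemma poly_cocard_poly: "poly (cocard_poly n X a) t = (\<Sum>I\<in>X. t ^ (n - card I) * a I)"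
  by (simp add: cocard_poly_def poly_sum poly_monom mult.commute)

lemma coeff_cocard_poly:
  assumes X: "X \<subseteq> Pow {0..<n}" and "j \<le> n"
  shows "coeff (cocard_poly n X a) (n - j) = (\<Sum>I\<in>{I\<in>X. card I = j}. a I)"
proof -
  have fin: "finite X" using X finite_subset by blast
  \<comment> \<open>Subtraction on naturals truncates; with this bound the exponent
    \<open>n - card I\<close> determines \<open>card I\<close>.\<close>
  have "card I \<le> n" if "I \<in> X" for I
    using that X card_mono[of "{0..<n}" I] by auto
  then have "n - card I = n - j \<longleftrightarrow> card I = j" if "I \<in> X" for I
    using that \<open>j \<le> n\<close> by fastforce
  then have "coeff (cocard_poly n X a) (n - j) = (\<Sum>I\<in>X. if card I = j then a I else 0)"
    by (auto simp: cocard_poly_def coeff_sum intro!: sum.cong)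
  also have "\<dots> = (\<Sum>I\<in>{I\<in>X. card I = j}. a I)"
    using fin by (simp add: sum.inter_filter)
  finally show ?thesis .
qed

text \<open>Compare coefficients of degree \<open>n\<close> in Sylvester's identity: the factor of
  degree \<open>r\<close> leaves the \<open>r\<close>-minors of \<open>F * H\<close>, the factor of
  degree \<open>n\<close> leaves the constant term of the characteristic expansion of
  \<open>H * F\<close>.\<close>

lemma sum_principal_minors_mult:
  fixes F H :: "'a :: {idom, ring_char_0} mat"
  assumes F: "F \<in> carrier_mat n r" and H: "H \<in> carrier_mat r n" and r: "r \<le> n"
  shows "(\<Sum>I\<in>{I\<in>Pow {0..<n}. card I = r}. det (submatrix (F * H) I I)) = det (H * F)"
proof -
  let ?p = "cocard_poly n (Pow {0..<n}) (\<lambda>I. det (submatrix (F * H) I I))"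
  let ?q = "cocard_poly r (Pow {0..<r}) (\<lambda>I. det (submatrix (H * F) I I))"
  have c: "F * H \<in> carrier_mat n n" "H * F \<in> carrier_mat r r" using F H by auto
  have p: "poly ?p t = det (t \<cdot>\<^sub>m 1\<^sub>m n + F * H)" for t
    by (simp add: poly_cocard_poly det_shift_principal_minors[OF c(1)])
  have q: "poly ?q t = det (t \<cdot>\<^sub>m 1\<^sub>m r + H * F)" for t
    by (simp add: poly_cocard_poly det_shift_principal_minors[OF c(2)])
  \<comment> \<open>Agreement at every \<open>t\<close> gives equality of polynomials, since a
    domain of characteristic 0 is infinite.\<close>
  have "poly (monom 1 r * ?p) = poly (monom 1 n * ?q)"
    by (rule ext) (simp add: poly_monom p q det_add_mult_commute[OF F H])
  then have "monom 1 r * ?p = monom 1 n * ?q"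
    by (simp add: poly_eq_poly_eq_iff)
  then have "coeff (monom 1 r * ?p) n = coeff (monom 1 n * ?q) n" by simp
  then have "coeff ?p (n - r) = coeff ?q 0"
    using r by (simp add: coeff_monom_mult)
  also have "\<dots> = det (H * F)"
  proof -
    have "0 \<cdot>\<^sub>m 1\<^sub>m r + H * F = H * F" using F H by (intro eq_matI) auto
    then show ?thesis by (simp add: poly_0_coeff_0[symmetric] q)
  qed
  finally show ?thesis using coeff_cocard_poly[OF subset_refl r, of "\<lambda>I. det (submatrix (F * H) I I)"] by simp
qed

lemma cramer_principal_minors:
  fixes F H :: "'a :: {idom, ring_char_0} mat"
  assumes F: "F \<in> carrier_mat n r" and H: "H \<in> carrier_mat r n" and r: "r \<le> n"
    and y: "y \<in> carrier_vec r" and i: "i < n"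
  defines "M \<equiv> F * H" and "x \<equiv> F *\<^sub>v y"
  shows "(\<Sum>I\<in>{I\<in>Pow {0..<n}. i \<in> I \<and> card I = r}. det (submatrix (replace_col M (M *\<^sub>v x) i) I I)) =
    x $ i * (\<Sum>I\<in>{I\<in>Pow {0..<n}. card I = r}. det (submatrix M I I))"
proof -
  let ?X = "{I\<in>Pow {0..<n}. i \<in> I}"
  define p where "p c = cocard_poly n ?X (\<lambda>I. det (submatrix (replace_col M c i) I I))" for c
  let ?q = "cocard_poly n (Pow {0..<n}) (\<lambda>I. det (submatrix M I I))"
  have M: "M \<in> carrier_mat n n" and x: "x \<in> carrier_vec n"
    using F H y by (auto simp: M_def x_def)
  have p: "poly (p c) t = det (replace_col (t \<cdot>\<^sub>m 1\<^sub>m n + M) c i)" for c t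
    by (simp add: p_def poly_cocard_poly det_shift_replace_col_principal_minors[OF M i])
  have q: "poly ?q t = det (t \<cdot>\<^sub>m 1\<^sub>m n + M)" for t
    by (simp add: poly_cocard_poly det_shift_principal_minors[OF M])
  have "poly ([:0,1:] * p x + p (M *\<^sub>v x)) = poly (Polynomial.smult (x $ i) ?q)"
  proof (rule ext)
    fix t
    let ?T = "t \<cdot>\<^sub>m 1\<^sub>m n + M"
    have T: "?T \<in> carrier_mat n n" using M by simp
    have "(t \<cdot>\<^sub>m 1\<^sub>m n) *\<^sub>v x = t \<cdot>\<^sub>v x"
      using x by (intro eq_vecI) auto
    then have Tx: "?T *\<^sub>v x = t \<cdot>\<^sub>v x + M *\<^sub>v x"
      using M x by (subst add_mult_distrib_mat_vec[of _ n n]) auto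
    have "poly ([:0,1:] * p x + p (M *\<^sub>v x)) t = det (replace_col ?T (?T *\<^sub>v x) i)"
      unfolding Tx using M x by (simp add: p det_replace_col_linear[OF T i])
    also have "\<dots> = poly (Polynomial.smult (x $ i) ?q) t"
      by (simp add: cramer_lemma_mat[OF T x i] q)
    finally show "poly ([:0,1:] * p x + p (M *\<^sub>v x)) t = poly (Polynomial.smult (x $ i) ?q) t" .
  qed
  then have eq: "[:0,1:] * p x + p (M *\<^sub>v x) = Polynomial.smult (x $ i) ?q"
    by (simp only: poly_eq_poly_eq_iff)
  \<comment> \<open>The factor \<open>t\<close> shifts degrees by one, so for \<open>r < n\<close>
    this is a sum of minors of size \<open>r + 1\<close>. For \<open>r = n\<close> it is the
    constant term of a multiple of \<open>t\<close>.\<close>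
  have "coeff ([:0,1:] * p x) (n - r) = 0"
  proof (cases "r = n")
    case False
    with r have r': "Suc r \<le> n" "n - r = Suc (n - Suc r)" by auto
    \<comment> \<open>Since \<open>x\<close> is \<open>F\<close> applied to \<open>y\<close>,
      replacing the column keeps the matrix factored through dimension \<open>r\<close>.\<close>
    have "replace_col M x i = F * replace_col H y i"
      using F H y by (intro eq_matI)
        (auto simp: M_def x_def replace_col_def scalar_prod_def intro!: sum.cong)
    then have "det (submatrix (replace_col M x i) I I) = 0" if "I \<subseteq> {0..<n}" "card I = Suc r" for I
      using minor_mult_eq_0[OF F, of "replace_col H y i" I] that H by simp
    then have "coeff (p x) (n - Suc r) = 0"
      unfolding p_def by (subst coeff_cocard_poly[OF _ r'(1)]) (auto intro!: sum.neutral)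
    then show ?thesis using r'(2) by (simp add: coeff_pCons)
  qed simp
  with arg_cong[OF eq, of "\<lambda>p. coeff p (n - r)"]
  have "coeff (p (M *\<^sub>v x)) (n - r) = x $ i * coeff ?q (n - r)" by simp
  moreover have "coeff (p (M *\<^sub>v x)) (n - r) =
      (\<Sum>I\<in>{I\<in>Pow {0..<n}. i \<in> I \<and> card I = r}. det (submatrix (replace_col M (M *\<^sub>v x) i) I I))"
    unfolding p_def by (subst coeff_cocard_poly[OF _ r]) (auto intro!: sum.cong)
  moreover have "coeff ?q (n - r) = (\<Sum>I\<in>{I\<in>Pow {0..<n}. card I = r}. det (submatrix M I I))"
    by (subst coeff_cocard_poly[OF _ r]) auto
  ultimately show ?thesis by simp
qed

section \<open>Rank factorization and the Drazin inverse\<close>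

text \<open>Associativity with side conditions on dimensions only, which the simplifier discharges
  from \<open>carrier_matD\<close> facts.\<close>

lemma mult_mat_assoc:
  "dim_col A = dim_row B \<Longrightarrow> dim_col B = dim_row C \<Longrightarrow> A * B * C = A * (B * C)"
  by (rule assoc_mult_mat[of A "dim_row A" "dim_col A" B "dim_col B" C "dim_col C"]) auto

lemma factor_throughI:
  assumes F: "F \<in> carrier_mat n r" and B: "B \<in> carrier_mat n m"
    and ex: "\<And>j. j < m \<Longrightarrow> \<exists>v\<in>carrier_vec r. F *\<^sub>v v = col B j"
  shows "\<exists>G\<in>carrier_mat r m. B = F * G"
proof -
  obtain g where g: "\<And>j. j < m \<Longrightarrow> g j \<in> carrier_vec r \<and> F *\<^sub>v g j = col B j"
    using ex by metis
  define G where "G = mat_of_cols r (map g [0..<m])"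
  have G: "G \<in> carrier_mat r m" by (auto simp: G_def mat_of_cols_carrier)
  have "B = F * G"
  proof (rule mat_col_eqI)
    fix j assume "j < dim_col (F * G)"
    then have j: "j < m" using G by simp
    then have "col G j = g j" using g by (simp add: G_def)
    then show "col B j = col (F * G) j"
      using g[OF j] j by (simp add: col_mult2[OF F G j])
  qed (use F B G in auto)
  with G show ?thesis by blast
qed

context vec_space
begin

text \<open>The columns of \<open>F\<close> are a maximal independent set of columns of
  \<open>A\<close>. By maximality they span all columns, which gives \<open>G\<close>; being columns
  of \<open>A\<close> themselves, they are selected by unit vectors, which gives \<open>W\<close>;
  independence is the trivial kernel.\<close>

lemma rank_factorization:
  assumes A: "A \<in> carrier_mat n m"
  obtains F G W where "F \<in> carrier_mat n (rank A)" "G \<in> carrier_mat (rank A) m" "W \<in> carrier_mat m (rank A)"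
    "A = F * G" "F = A * W"
    "\<And>v. v \<in> carrier_vec (rank A) \<Longrightarrow> F *\<^sub>v v = 0\<^sub>v n \<Longrightarrow> v = 0\<^sub>v (rank A)"
proof -
  let ?S = "set (cols A)"
  have S: "?S \<subseteq> carrier_vec n" using A cols_dim by blast
  have "\<exists>U. finite U \<and> maximal U (\<lambda>T. T \<subseteq> ?S \<and> lin_indpt T) \<and> {} \<subseteq> U"
    by (rule maximal_exists_superset[of ?S]) (auto simp: lin_dep_def)
  then obtain U where max: "maximal U (\<lambda>T. T \<subseteq> ?S \<and> lin_indpt T)" and fin: "finite U" by blast
  have U: "U \<subseteq> ?S" and indpt: "lin_indpt U" using max by (auto simp: maximal_def)
  have UV: "U \<subseteq> carrier_vec n" using U S by blast
  have span: "s \<in> span U" if s: "s \<in> ?S" for s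
  proof (rule ccontr)
    assume not: "s \<notin> span U"
    have "s \<notin> U" using not UV span_mem by auto
    have "lin_indpt (U \<union> {s})"
      using lin_dep_iff_in_span[of U s] UV indpt S s not \<open>s \<notin> U\<close> by auto
    then have "U = U \<union> {s}" using max U s unfolding maximal_def by blast
    then show False using \<open>s \<notin> U\<close> by blast
  qed
  obtain fs where fs: "set fs = U" "distinct fs" using finite_distinct_list[OF fin] by blast
  have len: "length fs = rank A"
    using rank_card_indpt[OF A max] distinct_card[OF fs(2)] fs(1) by simp
  define F where "F = mat_of_cols n fs"
  have F: "F \<in> carrier_mat n (rank A)" by (simp add: F_def len[symmetric])
  have colsF: "cols F = fs" unfolding F_def by (rule cols_mat_of_cols) (use fs UV in auto)
  have inj: "v = 0\<^sub>v (rank A)" if "v \<in> carrier_vec (rank A)" "F *\<^sub>v v = 0\<^sub>v n" for v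
    using lin_depI[OF F that(1) _ that(2)] colsF fs indpt by auto
  have "\<exists>G\<in>carrier_mat (rank A) m. A = F * G"
  proof (rule factor_throughI[OF F A])
    fix j assume "j < m"
    then have "col A j \<in> ?S" using A by (auto simp: cols_def)
    then have "col A j \<in> span U" by (rule span)
    then obtain a where "lincomb a U = col A j"
      using finite_in_span[OF fin, of "col A j"] UV by auto
    then have "F *\<^sub>v vec (rank A) (\<lambda>i. a (col F i)) = col A j"
      using mat_mult_eq_lincomb[OF F, of a] colsF fs by simp
    then show "\<exists>v\<in>carrier_vec (rank A). F *\<^sub>v v = col A j" by (intro bexI[of _ "vec (rank A) (\<lambda>i. a (col F i))"]) auto
  qed
  moreover have "\<exists>W\<in>carrier_mat m (rank A). F = A * W"
  proof (rule factor_throughI[OF A F])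
    fix j assume "j < rank A"
    then have "col F j \<in> set (cols F)" using F by (auto simp: cols_def)
    then have "col F j \<in> ?S" using U fs colsF by blast
    then obtain k where k: "k < m" "col F j = col A k"
      using A by (auto simp: cols_def)
    then have "A *\<^sub>v unit_vec m k = col F j" using A by (intro eq_vecI) auto
    then show "\<exists>v\<in>carrier_vec m. A *\<^sub>v v = col F j" by (intro bexI[of _ "unit_vec m k"]) auto
  qed
  ultimately show thesis using that F inj by blast
qed

end

lemma mult_mat_left_cancel:
  fixes F :: "'a :: comm_ring_1 mat"
  assumes F: "F \<in> carrier_mat n r" and P: "P \<in> carrier_mat r m" and Q: "Q \<in> carrier_mat r m"
    and inj: "\<And>v. v \<in> carrier_vec r \<Longrightarrow> F *\<^sub>v v = 0\<^sub>v n \<Longrightarrow> v = 0\<^sub>v r"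
    and eq: "F * P = F * Q"
  shows "P = Q"
proof (rule mat_col_eqI)
  fix j assume "j < dim_col Q"
  then have j: "j < m" using Q by simp
  have c: "col P j \<in> carrier_vec r" "col Q j \<in> carrier_vec r" using P Q j by auto
  have "F *\<^sub>v col P j = F *\<^sub>v col Q j"
    using eq col_mult2[OF F P j] col_mult2[OF F Q j] by simp
  then have "F *\<^sub>v (col P j - col Q j) = 0\<^sub>v n"
    using F c by (simp add: mult_minus_distrib_mat_vec[OF F])
  then have z: "col P j - col Q j = 0\<^sub>v r" using inj c by simp
  show "col P j = col Q j"
  proof (rule eq_vecI)
    fix i assume "i < dim_vec (col Q j)"
    then have "i < r" using Q by simp
    then show "col P j $ i = col Q j $ i"
      using arg_cong[OF z, of "\<lambda>w. w $ i"] P Q by simp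
  qed (use P Q in simp)
qed (use P Q in auto)

text \<open>The condition under \<open>THE\<close> in \<open>drazin\<close>, with the exponent
  \<open>k\<close> as a parameter in place of the index.\<close>

definition is_drazin_inverse :: "nat \<Rightarrow> nat \<Rightarrow> 'a :: semiring_1 mat \<Rightarrow> 'a mat \<Rightarrow> bool" where
  "is_drazin_inverse n k A X \<longleftrightarrow> X \<in> carrier_mat n n \<and>
      A ^\<^sub>m (k + 1) * X = A ^\<^sub>m k \<and> X * A * X = X \<and> A * X = X * A"

section \<open>Uniqueness of the Drazin inverse\<close>

lemma pow_mat_commute:
  assumes A: "A \<in> carrier_mat n n" and X: "X \<in> carrier_mat n n" and comm: "A * X = X * A"
  shows "A ^\<^sub>m j * X = X * A ^\<^sub>m j"
proof (induction j)
  case 0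
  then show ?case using A X by simp
next
  case (Suc j)
  note [simp] = carrier_matD[OF A] carrier_matD[OF X]
  have "A ^\<^sub>m Suc j * X = A ^\<^sub>m j * (A * X)" by (simp add: mult_mat_assoc)
  also have "\<dots> = A ^\<^sub>m j * X * A" unfolding comm by (simp add: mult_mat_assoc)
  also have "\<dots> = X * A ^\<^sub>m Suc j" unfolding Suc by (simp add: mult_mat_assoc)
  finally show ?case .
qed

lemma pow_mat_Suc_left:
  assumes A: "A \<in> carrier_mat n n"
  shows "A ^\<^sub>m Suc j = A * A ^\<^sub>m j"
  using pow_mat_commute[OF A A refl, of j] by simp

text \<open>Commutation turns \<open>X * A * X = X\<close> into \<open>X = A * X * X\<close> and
  \<open>X = X * (X * A)\<close>. Inserting a factorization of \<open>X\<close> for one occurrence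
  on the right raises the power of \<open>A\<close> by one.\<close>

lemma outer_inverse_factor_pow:
  assumes A: "A \<in> carrier_mat n n" and X: "X \<in> carrier_mat n n"
    and XAX: "X * A * X = X" and comm: "A * X = X * A"
  shows "\<exists>P\<in>carrier_mat n n. X = A ^\<^sub>m j * P" "\<exists>P\<in>carrier_mat n n. X = P * A ^\<^sub>m j"
proof -
  note [simp] = carrier_matD[OF A] carrier_matD[OF X]
  show "\<exists>P\<in>carrier_mat n n. X = A ^\<^sub>m j * P"
  proof (induction j)
    case 0
    then show ?case using A X by auto
  next
    case (Suc j)
    then obtain P where P: "P \<in> carrier_mat n n" "X = A ^\<^sub>m j * P" by blast
    note [simp] = carrier_matD[OF P(1)]
    have "X = A * X * X" using XAX comm by simp
    \<comment> \<open>The explicit context makes the substitution act on only one of the two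
      occurrences of \<open>X\<close>.\<close>
    also have "\<dots> = A * (A ^\<^sub>m j * P) * X" by (rule arg_cong[OF P(2), of "\<lambda>Z. A * Z * X"])
    also have "\<dots> = A ^\<^sub>m Suc j * (P * X)"
      unfolding pow_mat_Suc_left[OF A] by (simp add: mult_mat_assoc)
    finally show ?case using mult_carrier_mat[OF P(1) X] by blast
  qed
  show "\<exists>P\<in>carrier_mat n n. X = P * A ^\<^sub>m j"
  proof (induction j)
    case 0
    then show ?case using A X by auto
  next
    case (Suc j)
    then obtain P where P: "P \<in> carrier_mat n n" "X = P * A ^\<^sub>m j" by blast
    note [simp] = carrier_matD[OF P(1)]
    have "X = X * (X * A)" using XAX comm by (simp add: mult_mat_assoc)
    also have "\<dots> = X * ((P * A ^\<^sub>m j) * A)" by (rule arg_cong[OF P(2), of "\<lambda>Z. X * (Z * A)"])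
    also have "\<dots> = (X * P) * A ^\<^sub>m Suc j" by (simp add: mult_mat_assoc)
    finally show ?case using mult_carrier_mat[OF X P(1)] by blast
  qed
qed

text \<open>Both inverses equal \<open>X * A * Y\<close>: write \<open>X = P * A ^\<^sub>m k\<close>
  and expand the power by the first equation for \<open>Y\<close>; write
  \<open>Y = A ^\<^sub>m k * Q\<close> and expand by the one for \<open>X\<close>.\<close>

lemma is_drazin_inverse_unique:
  assumes A: "A \<in> carrier_mat n n"
    and "is_drazin_inverse n k A X" and "is_drazin_inverse n k A Y"
  shows "X = Y"
proof -
  from assms(2) have X: "X \<in> carrier_mat n n" and X1: "A ^\<^sub>m (k + 1) * X = A ^\<^sub>m k"
    and X2: "X * A * X = X" and X3: "A * X = X * A" by (auto simp: is_drazin_inverse_def)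
  from assms(3) have Y: "Y \<in> carrier_mat n n" and Y1: "A ^\<^sub>m (k + 1) * Y = A ^\<^sub>m k"
    and Y2: "Y * A * Y = Y" and Y3: "A * Y = Y * A" by (auto simp: is_drazin_inverse_def)
  obtain P where P: "P \<in> carrier_mat n n" "X = P * A ^\<^sub>m k"
    using outer_inverse_factor_pow(2)[OF A X X2 X3] by blast
  obtain Q where Q: "Q \<in> carrier_mat n n" "Y = A ^\<^sub>m k * Q"
    using outer_inverse_factor_pow(1)[OF A Y Y2 Y3] by blast
  note [simp] = carrier_matD[OF A] carrier_matD[OF X] carrier_matD[OF Y]
    carrier_matD[OF P(1)] carrier_matD[OF Q(1)]
  have "X = P * (A ^\<^sub>m (k + 1) * Y)" unfolding Y1 by (rule P(2))
  also have "\<dots> = (P * A ^\<^sub>m k) * A * Y" by (simp add: mult_mat_assoc)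
  finally have XY: "X = X * A * Y" unfolding P(2)[symmetric] .
  have "Y = A ^\<^sub>m (k + 1) * X * Q" unfolding X1 by (rule Q(2))
  also have "\<dots> = X * A ^\<^sub>m Suc k * Q"
    using pow_mat_commute[OF A X X3, of "k + 1"] by simp
  also have "\<dots> = X * A * (A ^\<^sub>m k * Q)"
    unfolding pow_mat_Suc_left[OF A] by (simp add: mult_mat_assoc)
  finally have "Y = X * A * Y" unfolding Q(2)[symmetric] .
  with XY show ?thesis by simp
qed

section \<open>Construction of the Drazin inverse from a rank factorization\<close>

lemma det_pow_mat:
  fixes C :: "'a :: comm_ring_1 mat"
  assumes C: "C \<in> carrier_mat n n"
  shows "det (C ^\<^sub>m j) = det C ^ j"
proof (induction j)
  case (Suc j)
  then show ?case using det_mult[of "C ^\<^sub>m j" n C] C by (simp add: mult.commute)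
qed simp

lemma ex_inverse_mat:
  fixes N :: "'a :: field mat"
  assumes N: "N \<in> carrier_mat n n" and det: "det N \<noteq> 0"
  obtains K where "K \<in> carrier_mat n n" "N * K = 1\<^sub>m n" "K * N = 1\<^sub>m n"
  using det_non_zero_imp_unit[OF N det] that by (auto simp: Units_def ring_mat_def)

lemma drazin_inverse_factorization:
  fixes A :: "'a :: field mat"
  assumes A: "A \<in> carrier_mat n n"
    and rank: "vec_space.rank n (A ^\<^sub>m k) = r" "vec_space.rank n (A ^\<^sub>m Suc k) = r"
  obtains F H E where "F \<in> carrier_mat n r" "H \<in> carrier_mat r n" "E \<in> carrier_mat r n"
    "A ^\<^sub>m Suc k = F * H" "det (H * F) \<noteq> 0" "is_drazin_inverse n k A (F * E)"
proof -
  interpret vec_space "TYPE('a)" n .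
  have pow: "A ^\<^sub>m k \<in> carrier_mat n n" "A ^\<^sub>m Suc k \<in> carrier_mat n n"
    using A by (auto intro: pow_carrier_mat simp del: pow_mat.simps)
  obtain F G W where F: "F \<in> carrier_mat n r" and G: "G \<in> carrier_mat r n" and W: "W \<in> carrier_mat n r"
    and FG: "A ^\<^sub>m k = F * G" and FW: "F = A ^\<^sub>m k * W"
    and inj: "\<And>v. v \<in> carrier_vec r \<Longrightarrow> F *\<^sub>v v = 0\<^sub>v n \<Longrightarrow> v = 0\<^sub>v r"
    using rank_factorization[OF pow(1)] unfolding rank(1) by metis
  \<comment> \<open>A second injective matrix with \<open>r\<close> columns, inside the range of the
    next power; it serves to show that \<open>C\<close> is invertible.\<close>
  obtain F' W' where F': "F' \<in> carrier_mat n r" and W': "W' \<in> carrier_mat n r"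
    and FW': "F' = A ^\<^sub>m Suc k * W'"
    and inj': "\<And>v. v \<in> carrier_vec r \<Longrightarrow> F' *\<^sub>v v = 0\<^sub>v n \<Longrightarrow> v = 0\<^sub>v r"
    using rank_factorization[OF pow(2)] unfolding rank(2) by metis
  \<comment> \<open>The matrix of \<open>A\<close> on the range of \<open>F\<close>: by
    \<open>FW\<close> and \<open>FG\<close>, \<open>A * F\<close> is the next power times
    \<open>W\<close>, that is \<open>F * (G * A * W)\<close>.\<close>
  define C where "C = G * A * W"
  have C: "C \<in> carrier_mat r r" using G A W by (auto simp: C_def)
  note dims [simp] = carrier_matD[OF A] carrier_matD[OF F] carrier_matD[OF G] carrier_matD[OF W]
    carrier_matD[OF W'] carrier_matD[OF C]
  note cancel = mult_mat_left_cancel[OF F _ _ inj]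
  have AF: "A * F = F * C"
  proof -
    have "A * F = A ^\<^sub>m Suc k * W"
      unfolding pow_mat_Suc_left[OF A] by (subst FW) (simp add: mult_mat_assoc)
    also have "\<dots> = F * C" by (simp add: FG C_def mult_mat_assoc)
    finally show ?thesis .
  qed
  have AF_mult: "A * (F * Z) = F * (C * Z)" if "dim_row Z = r" for Z
    using mult_mat_assoc[of A F Z] mult_mat_assoc[of F C Z] that by (simp add: AF)
  have pow_Suc: "A ^\<^sub>m Suc k = F * (C * G)"
    unfolding pow_mat_Suc_left[OF A] FG by (rule AF_mult) simp
  have GA: "G * A = C * G"
  proof (rule cancel)
    show "F * (G * A) = F * (C * G)"
      unfolding pow_Suc[symmetric] by (simp add: FG mult_mat_assoc)
    show "G * A \<in> carrier_mat r n" "C * G \<in> carrier_mat r n"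
      using A C G by (simp_all add: mult_carrier_mat)
  qed
  have pow_F: "A ^\<^sub>m j * F = F * C ^\<^sub>m j" for j
  proof (induction j)
    case (Suc j)
    have "A ^\<^sub>m Suc j * F = A ^\<^sub>m j * F * C" by (simp add: mult_mat_assoc AF)
    also have "\<dots> = F * C ^\<^sub>m Suc j" unfolding Suc by (simp add: mult_mat_assoc)
    finally show ?case .
  qed (use F in simp)
  have GF: "G * F = C ^\<^sub>m k"
  proof (rule cancel)
    show "F * (G * F) = F * C ^\<^sub>m k"
      unfolding pow_F[symmetric] by (simp add: FG mult_mat_assoc)
    show "G * F \<in> carrier_mat r r" "C ^\<^sub>m k \<in> carrier_mat r r"
      using F C G by (simp_all add: pow_carrier_mat)
  qed
  have "det C \<noteq> 0"
  proof -
    \<comment> \<open>As \<open>F'\<close> is \<open>F * ?T\<close> and injective, \<open>?T\<close>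
      has trivial kernel. Equality of the two ranks makes \<open>?T\<close> square, so its
      determinant, and with it that of the factor \<open>C\<close>, is nonzero.\<close>
    let ?T = "C * (G * W')"
    have GW': "G * W' \<in> carrier_mat r r" and T: "?T \<in> carrier_mat r r" using C G W' by auto
    have "F' = F * ?T" unfolding FW' pow_Suc by (simp add: mult_mat_assoc)
    moreover have "F *\<^sub>v 0\<^sub>v r = 0\<^sub>v n" by (intro eq_vecI) (auto simp: scalar_prod_def)
    ultimately have "v = 0\<^sub>v r" if "v \<in> carrier_vec r" "?T *\<^sub>v v = 0\<^sub>v r" for v
      using inj'[of v] that F T by simp
    then have "det ?T \<noteq> 0" using det_0_iff_vec_prod_zero_field[OF T] by blast
    then show ?thesis using det_mult[OF C GW'] by auto
  qed
  \<comment> \<open>This is \<open>H * F\<close> for \<open>H = C * G\<close>, because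
    \<open>G * F\<close> is the \<open>k\<close>-th power of \<open>C\<close>.\<close>
  define N where "N = C ^\<^sub>m Suc k"
  have N: "N \<in> carrier_mat r r" using pow_carrier_mat[OF C] by (simp only: N_def)
  have "det N \<noteq> 0" using \<open>det C \<noteq> 0\<close> by (simp add: N_def det_pow_mat[OF C] del: pow_mat.simps)
  then obtain K where K: "K \<in> carrier_mat r r" and NK: "N * K = 1\<^sub>m r" and KN: "K * N = 1\<^sub>m r"
    using ex_inverse_mat[OF N] by blast
  note [simp] = carrier_matD[OF N] carrier_matD[OF K]
  have CN: "N = C * C ^\<^sub>m k" "N = C ^\<^sub>m k * C"
    unfolding N_def by (rule pow_mat_Suc_left[OF C]) simp
  \<comment> \<open>The inverse \<open>K\<close> of \<open>N\<close> commutes with \<open>C\<close>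
    because \<open>N\<close>, a power of \<open>C\<close>, does.\<close>
  have KC: "K * C = C * K"
  proof -
    have "K * C = K * (C * N) * K" using C K by (simp add: mult_mat_assoc NK)
    also have "C * N = N * C" unfolding N_def by (rule pow_mat_commute[OF C C refl, symmetric])
    also have "K * (N * C) * K = (K * N) * (C * K)" by (simp add: mult_mat_assoc)
    also have "\<dots> = C * K" using C K by (simp add: KN)
    finally show ?thesis .
  qed
  show thesis
  \<comment> \<open>The witnesses are \<open>H = C * G\<close> and \<open>E = K * G\<close>, where
    \<open>K\<close> inverts the power \<open>N\<close> of \<open>C\<close>.\<close>
  proof (rule that)
    show "F \<in> carrier_mat n r" "C * G \<in> carrier_mat r n" "K * G \<in> carrier_mat r n"
      using F C G K by auto
    show "A ^\<^sub>m Suc k = F * (C * G)" by (rule pow_Suc)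
    have "C * G * F = N" by (simp add: CN(1) GF mult_mat_assoc)
    then show "det (C * G * F) \<noteq> 0" using \<open>det N \<noteq> 0\<close> by simp
    have AX: "A * (F * (K * G)) = F * (C * (K * G))"
      by (rule AF_mult) simp
    have "F * (K * G) * A = F * (K * (G * A))" by (simp add: mult_mat_assoc)
    also have "\<dots> = F * ((K * C) * G)" by (simp add: GA mult_mat_assoc)
    also have "\<dots> = A * (F * (K * G))" by (simp add: KC AX mult_mat_assoc)
    finally have XA: "F * (K * G) * A = A * (F * (K * G))" .
    have "A ^\<^sub>m Suc k * (F * (K * G)) = F * (C * (G * F) * (K * G))"
      unfolding pow_Suc by (simp add: mult_mat_assoc)
    also have "\<dots> = F * ((N * K) * G)" by (simp add: GF CN(1) mult_mat_assoc)
    also have "\<dots> = A ^\<^sub>m k" using G by (simp add: NK FG)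
    finally have pX: "A ^\<^sub>m Suc k * (F * (K * G)) = A ^\<^sub>m k" .
    have "F * (K * G) * A * (F * (K * G)) = F * (K * G) * (F * (C * (K * G)))"
      by (simp add: AX mult_mat_assoc)
    also have "\<dots> = F * (K * ((G * F) * C) * (K * G))" by (simp add: mult_mat_assoc)
    also have "\<dots> = F * ((K * N) * (K * G))" by (simp add: GF CN(2) mult_mat_assoc)
    also have "\<dots> = F * (K * G)" using K G by (simp add: KN)
    finally have XAX: "F * (K * G) * A * (F * (K * G)) = F * (K * G)" .
    show "is_drazin_inverse n k A (F * (K * G))"
      using pX XAX XA F K G by (auto simp: is_drazin_inverse_def simp del: pow_mat.simps)
  qed
qed

section \<open>Cramer's rule for the Drazin inverse solution\<close>

theorem theorem4p5:
  fixes A B :: "complex mat" and n m k r :: nat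
  assumes "A \<in> carrier_mat n n" and "B \<in> carrier_mat n m"
    and "mat_ind n A = k"
    and "crank n (A ^\<^sub>m (k+1)) = r" and "crank n (A ^\<^sub>m k) = r" and "r \<le> n"
  shows "\<forall>i<n. \<forall>j<m.
    (drazin n A * B) $$ (i,j) =
      (\<Sum>\<beta>\<in>{\<beta>\<in>Jrn r n. i \<in> \<beta>}.
          det (submatrix (replace_col (A ^\<^sub>m (k+1)) (col (A ^\<^sub>m k * B) j) i) \<beta> \<beta>))
      / (\<Sum>\<beta>\<in>Jrn r n. det (submatrix (A ^\<^sub>m (k+1)) \<beta> \<beta>))"
proof (intro allI impI)
  fix i j assume i: "i < n" and j: "j < m"
  note A = assms(1) and B = assms(2)
  obtain F H E where F: "F \<in> carrier_mat n r" and H: "H \<in> carrier_mat r n" and E: "E \<in> carrier_mat r n"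
    and M: "A ^\<^sub>m (k+1) = F * H" and det: "det (H * F) \<noteq> 0"
    and X: "is_drazin_inverse n k A (F * E)"
    using drazin_inverse_factorization[OF A, of k r] assms(4,5) unfolding crank_def by auto
  have "drazin n A = (THE X. is_drazin_inverse n k A X)"
    by (simp only: drazin_def is_drazin_inverse_def assms(3))
  also have "\<dots> = F * E"
    using X is_drazin_inverse_unique[OF A] by blast
  finally have drazin: "drazin n A = F * E" .
  note [simp] = carrier_matD[OF A] carrier_matD[OF B] carrier_matD[OF F] carrier_matD[OF H] carrier_matD[OF E]
  \<comment> \<open>Coordinates of the \<open>j\<close>-th solution column with respect to the
    columns of \<open>F\<close>.\<close>
  define y where "y = col (E * B) j"
  have y: "y \<in> carrier_vec r" using E B j by (simp add: y_def)
  have EB: "E * B \<in> carrier_mat r m" and FEB: "F * E * B \<in> carrier_mat n m"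
    and FH: "F * H \<in> carrier_mat n n" using E F B H by auto
  have x: "F *\<^sub>v y = col (F * E * B) j"
    unfolding y_def col_mult2[OF F EB j, symmetric] by (simp add: mult_mat_assoc)
  \<comment> \<open>The first Drazin equation, multiplied by \<open>B\<close>; it exhibits the
    replacing column as \<open>M\<close> applied to the solution column.\<close>
  have "F * H * (F * E * B) = A ^\<^sub>m k * B"
    using X by (simp add: is_drazin_inverse_def M[symmetric] mult_mat_assoc[symmetric] del: assoc_mult_mat pow_mat.simps)
  then have c: "F * H *\<^sub>v (F *\<^sub>v y) = col (A ^\<^sub>m k * B) j"
    unfolding x by (metis col_mult2[OF FH FEB j])
  have J: "{I\<in>Pow {0..<n}. card I = r} = Jrn r n"
    "{I\<in>Pow {0..<n}. i \<in> I \<and> card I = r} = {\<beta>\<in>Jrn r n. i \<in> \<beta>}"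
    by (auto simp: Jrn_def)
  \<comment> \<open>The denominator is \<open>det (H * F)\<close>, so the identity may be divided by
    it.\<close>
  have "(\<Sum>\<beta>\<in>Jrn r n. det (submatrix (F * H) \<beta> \<beta>)) \<noteq> 0"
    using sum_principal_minors_mult[OF F H assms(6)] det unfolding J by simp
  moreover have "(drazin n A * B) $$ (i,j) = (F *\<^sub>v y) $ i"
    unfolding drazin x using i j by simp
  ultimately show "(drazin n A * B) $$ (i,j) =
      (\<Sum>\<beta>\<in>{\<beta>\<in>Jrn r n. i \<in> \<beta>}.
          det (submatrix (replace_col (A ^\<^sub>m (k+1)) (col (A ^\<^sub>m k * B) j) i) \<beta> \<beta>))
      / (\<Sum>\<beta>\<in>Jrn r n. det (submatrix (A ^\<^sub>m (k+1)) \<beta> \<beta>))"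
    using cramer_principal_minors[OF F H assms(6) y i] unfolding c J M by simp
qed

end
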